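(* Let $G$ be a finite group. For any $G$-transfer system $\mathcal{O}$, the maximal compatible transfer system $\mathrm{M}(\mathcal{O})$ is saturated.
   Context: For a finite group $G$, a $G$-transfer system $\mathcal{O}$ is a binary relation $\to$ on the set of subgroups of $G$, refining inclusion ($K\to H$ implies $K\le H$), such that: $H\to H$ for all $H\le G$; $K\to H$ implies $gKg^{-1}\to gHg^{-1}$ for all $g\in G$; $K\to H$ and $L\le H$ imply $K\cap L\to L$; and $L\to K$, $K\to H$ imply $L\to H$. Its elements are called transfers. $\mathcal{O}$ is saturated if whenever $L\le K\le H\le G$ and $L\to H$ is in $\mathcal{O}$, then $K\to H$ is in $\mathcal{O}$. A pair $(\mathcal{O}_a,\mathcal{O}_m)$ of $G$-transfer systems is compatible if $\mathcal{O}_m\subseteq\mathcal{O}_a$ and, for all $K,J\le H\le G$, if $K\to H$ is in $\mathcal{O}_m$ and $K\cap J\to K$ is in $\mathcal{O}_a$, then $J\to H$ is in $\mathcal{O}_a$. $\mathrm{M}(\mathcal{O})$ denotes the unique largest (under containment) $G$-transfer system such that $(\mathcal{O},\mathrm{M}(\mathcal{O}))$ is compatible. *)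

theory Defs
  imports "HOL-Algebra.Algebra"
begin

text \<open>A transfer \<open>K \<rightarrow> H\<close> in \<open>T\<close> is written \<open>(K, H) \<in> T\<close>.\<close>

definition transfer_system :: "('a, 'b) monoid_scheme \<Rightarrow> ('a set \<times> 'a set) set \<Rightarrow> bool" where
  "transfer_system G T \<longleftrightarrow>
     (\<forall>K H. (K, H) \<in> T \<longrightarrow> subgroup K G \<and> subgroup H G \<and> K \<subseteq> H) \<and>
     (\<forall>H. subgroup H G \<longrightarrow> (H, H) \<in> T) \<and>
     (\<forall>K H. \<forall>g\<in>carrier G. (K, H) \<in> T \<longrightarrow>
        (g <#\<^bsub>G\<^esub> K #>\<^bsub>G\<^esub> inv\<^bsub>G\<^esub> g, g <#\<^bsub>G\<^esub> H #>\<^bsub>G\<^esub> inv\<^bsub>G\<^esub> g) \<in> T) \<and>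
     (\<forall>K H L. (K, H) \<in> T \<and> subgroup L G \<and> L \<subseteq> H \<longrightarrow> (K \<inter> L, L) \<in> T) \<and>
     (\<forall>L K H. (L, K) \<in> T \<and> (K, H) \<in> T \<longrightarrow> (L, H) \<in> T)"

definition saturated_transfer_system ::
    "('a, 'b) monoid_scheme \<Rightarrow> ('a set \<times> 'a set) set \<Rightarrow> bool" where
  "saturated_transfer_system G T \<longleftrightarrow>
     transfer_system G T \<and>
     (\<forall>L K H. subgroup L G \<and> subgroup K G \<and> subgroup H G \<and> L \<subseteq> K \<and> K \<subseteq> H \<and> (L, H) \<in> T
        \<longrightarrow> (K, H) \<in> T)"

definition compatible_transfer_systems ::
    "('a, 'b) monoid_scheme \<Rightarrow> ('a set \<times> 'a set) set \<Rightarrow> ('a set \<times> 'a set) set \<Rightarrow> bool" where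
  "compatible_transfer_systems G Ta Tm \<longleftrightarrow>
     transfer_system G Ta \<and> transfer_system G Tm \<and> Tm \<subseteq> Ta \<and>
     (\<forall>K J H. subgroup K G \<and> subgroup J G \<and> subgroup H G \<and> K \<subseteq> H \<and> J \<subseteq> H \<and>
        (K, H) \<in> Tm \<and> (K \<inter> J, K) \<in> Ta \<longrightarrow> (J, H) \<in> Ta)"

text \<open>\<open>M(T)\<close>: the order on relations is inclusion. \<open>Greatest\<close> is a definite description, so the
  existence of \<open>M(T)\<close> is not built into the definition.\<close>

definition max_compatible ::
    "('a, 'b) monoid_scheme \<Rightarrow> ('a set \<times> 'a set) set \<Rightarrow> ('a set \<times> 'a set) set" where
  "max_compatible G T = (GREATEST M. compatible_transfer_systems G T M)"

end

theory Submission
  imports Defs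
begin

text \<open>
  The point is that \<open>M(T)\<close> has an explicit description. If \<open>(K, H)\<close> lies in a transfer system
  compatible with \<open>T\<close>, then so does every restriction \<open>(K \<inter> L, L)\<close> with \<open>L \<subseteq> H\<close>, and the
  compatibility condition for that restriction says that a pair \<open>J \<subseteq> L\<close> must be a transfer of \<open>T\<close>
  as soon as its trace \<open>K \<inter> J \<subseteq> K \<inter> L\<close> on \<open>K\<close> is one. So intersection with \<open>K\<close> has to
  reflect transfers below \<open>H\<close>. Conversely, the pairs \<open>(K, H)\<close> for which it does form a transfer
  system compatible with \<open>T\<close>, because reflecting transfers is stable under restriction, conjugation
  and composition. This relation is therefore \<open>M(T)\<close>.

  Saturation is now immediate. Let \<open>L \<subseteq> K \<subseteq> H\<close> and suppose that \<open>L\<close> reflects transfers below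
  \<open>H\<close>. If the trace of \<open>J \<subseteq> N\<close> on \<open>K\<close> is a transfer, then restricting it to \<open>L \<inter> N\<close> shows that
  the trace on \<open>L\<close> is a transfer too, hence so is \<open>(J, N)\<close>. Thus \<open>K\<close> reflects transfers below \<open>H\<close>.
\<close>

section \<open>Transfer systems and conjugation\<close>

abbreviation conjugate :: "('a, 'b) monoid_scheme \<Rightarrow> 'a \<Rightarrow> 'a set \<Rightarrow> 'a set" where
  "conjugate G g K \<equiv> g <#\<^bsub>G\<^esub> K #>\<^bsub>G\<^esub> inv\<^bsub>G\<^esub> g"

text \<open>The clauses of the definition are projected out one at a time, since proof search with the
  transitivity and restriction clauses in scope need not terminate.\<close>

lemma transfer_systemD:
  assumes "transfer_system G T" and "(K, H) \<in> T"
  shows transfer_subgroup_left: "subgroup K G"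
    and transfer_subgroup_right: "subgroup H G"
    and transfer_subset: "K \<subseteq> H"
  using assms(1)[unfolded transfer_system_def, THEN conjunct1] assms(2) by blast+

lemma transfer_refl:
  assumes "transfer_system G T" and "subgroup H G"
  shows "(H, H) \<in> T"
  using assms(1)[unfolded transfer_system_def, THEN conjunct2, THEN conjunct1] assms(2) by blast

lemma transfer_conj:
  assumes "transfer_system G T" and "g \<in> carrier G" and "(K, H) \<in> T"
  shows "(conjugate G g K, conjugate G g H) \<in> T"
  using assms(1)[unfolded transfer_system_def, THEN conjunct2, THEN conjunct2, THEN conjunct1]
    assms(2,3) by blast

lemma transfer_restrict:
  assumes "transfer_system G T" and "(K, H) \<in> T" and "subgroup L G" and "L \<subseteq> H"
  shows "(K \<inter> L, L) \<in> T"
  using assms(1)[unfolded transfer_system_def, THEN conjunct2, THEN conjunct2, THEN conjunct2,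
      THEN conjunct1] assms(2-4) by blast

context group
begin

lemma conj_eq_image: "conjugate G g K = (\<lambda>x. g \<otimes>\<^bsub>G\<^esub> x \<otimes>\<^bsub>G\<^esub> inv\<^bsub>G\<^esub> g) ` K"
  by (auto simp: l_coset_def r_coset_def)

lemma conj_mono: "K \<subseteq> H \<Longrightarrow> conjugate G g K \<subseteq> conjugate G g H"
  by (auto simp: conj_eq_image)

lemma conj_Int:
  assumes "g \<in> carrier G" and "K \<subseteq> carrier G" and "H \<subseteq> carrier G"
  shows "conjugate G g (K \<inter> H) = conjugate G g K \<inter> conjugate G g H"
  unfolding conj_eq_image
proof (rule inj_on_image_Int)
  show "inj_on (\<lambda>x. g \<otimes>\<^bsub>G\<^esub> x \<otimes>\<^bsub>G\<^esub> inv\<^bsub>G\<^esub> g) (carrier G)"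
    using assms(1) by (auto intro!: inj_onI)
qed (use assms in auto)

lemma conj_inv_conj:
  assumes "g \<in> carrier G" and "K \<subseteq> carrier G"
  shows "conjugate G (inv\<^bsub>G\<^esub> g) (conjugate G g K) = K"
proof -
  have "inv\<^bsub>G\<^esub> g \<otimes>\<^bsub>G\<^esub> (g \<otimes>\<^bsub>G\<^esub> x \<otimes>\<^bsub>G\<^esub> inv\<^bsub>G\<^esub> g) \<otimes>\<^bsub>G\<^esub> inv\<^bsub>G\<^esub> (inv\<^bsub>G\<^esub> g) = x" if "x \<in> K" for x
    using assms that by (simp add: m_assoc subsetD inv_solve_left')
  then show ?thesis
    unfolding conj_eq_image image_image by simp
qed

lemma conj_conj_inv:
  assumes "g \<in> carrier G" and "K \<subseteq> carrier G"
  shows "conjugate G g (conjugate G (inv\<^bsub>G\<^esub> g) K) = K"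
  using conj_inv_conj[of "inv\<^bsub>G\<^esub> g" K] assms by simp

end

text \<open>Conjugates of subgroups are subgroups because transfer systems are reflexive, closed under
  conjugation, and relate only subgroups.\<close>

lemma transfer_system_conj_subgroup:
  assumes "transfer_system G T" and "g \<in> carrier G" and "subgroup H G"
  shows "subgroup (conjugate G g H) G"
  using assms by (meson transfer_conj transfer_refl transfer_subgroup_left)

section \<open>Pairs along which transfers are reflected\<close>

definition reflecting ::
    "('a, 'b) monoid_scheme \<Rightarrow> ('a set \<times> 'a set) set \<Rightarrow> ('a set \<times> 'a set) set" where
  "reflecting G T = {(K, H). subgroup K G \<and> subgroup H G \<and> K \<subseteq> H \<and>
     (\<forall>J N. subgroup J G \<and> subgroup N G \<and> J \<subseteq> N \<and> N \<subseteq> H \<and> (K \<inter> J, K \<inter> N) \<in> T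
        \<longrightarrow> (J, N) \<in> T)}"

lemma reflectingI:
  assumes "subgroup K G" and "subgroup H G" and "K \<subseteq> H"
    and "\<And>J N. subgroup J G \<Longrightarrow> subgroup N G \<Longrightarrow> J \<subseteq> N \<Longrightarrow> N \<subseteq> H \<Longrightarrow>
           (K \<inter> J, K \<inter> N) \<in> T \<Longrightarrow> (J, N) \<in> T"
  shows "(K, H) \<in> reflecting G T"
  using assms unfolding reflecting_def by blast

lemma reflectingD:
  assumes "(K, H) \<in> reflecting G T"
  shows "subgroup K G" and "subgroup H G" and "K \<subseteq> H"
    and "subgroup J G \<Longrightarrow> subgroup N G \<Longrightarrow> J \<subseteq> N \<Longrightarrow> N \<subseteq> H \<Longrightarrow>
           (K \<inter> J, K \<inter> N) \<in> T \<Longrightarrow> (J, N) \<in> T"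
  using assms unfolding reflecting_def by blast+

text \<open>The pair \<open>(K, H)\<close> itself has the trace \<open>(K, K)\<close> on \<open>K\<close>.\<close>

lemma reflecting_subset:
  assumes "transfer_system G T"
  shows "reflecting G T \<subseteq> T"
proof (rule subrelI)
  fix K H assume KH: "(K, H) \<in> reflecting G T"
  then have "K \<inter> H = K" by (auto dest: reflectingD(3))
  then have "(K \<inter> K, K \<inter> H) \<in> T"
    using transfer_refl[OF assms reflectingD(1)[OF KH]] by simp
  then show "(K, H) \<in> T"
    using reflectingD[OF KH] by blast
qed

lemma (in group) reflecting_conj:
  assumes T: "transfer_system G T" and g: "g \<in> carrier G" and KH: "(K, H) \<in> reflecting G T"
  shows "(conjugate G g K, conjugate G g H) \<in> reflecting G T"
proof -
  have ig: "inv\<^bsub>G\<^esub> g \<in> carrier G" using g by simp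
  note KH' = reflectingD[OF KH]
  note conj_sub = transfer_system_conj_subgroup[OF T]
  show ?thesis
  proof (rule reflectingI)
    show "subgroup (conjugate G g K) G" "subgroup (conjugate G g H) G"
      using conj_sub[OF g] KH'(1,2) by blast+
    show "conjugate G g K \<subseteq> conjugate G g H"
      by (rule conj_mono[OF KH'(3)])
  next
    fix J N
    assume J: "subgroup J G" and N: "subgroup N G" and JN: "J \<subseteq> N"
      and NH: "N \<subseteq> conjugate G g H"
      and trace: "(conjugate G g K \<inter> J, conjugate G g K \<inter> N) \<in> T"
    define J' N' where "J' = conjugate G (inv\<^bsub>G\<^esub> g) J" and "N' = conjugate G (inv\<^bsub>G\<^esub> g) N"
    have conj_trace: "conjugate G (inv\<^bsub>G\<^esub> g) (conjugate G g K \<inter> A)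
        = K \<inter> conjugate G (inv\<^bsub>G\<^esub> g) A" if "subgroup A G" for A
      unfolding conj_Int[OF ig subgroup.subset[OF conj_sub[OF g KH'(1)]] subgroup.subset[OF that]]
      by (simp only: conj_inv_conj[OF g subgroup.subset[OF KH'(1)]])
    have "(K \<inter> J', K \<inter> N') \<in> T"
      using transfer_conj[OF T ig trace]
      unfolding conj_trace[OF J] conj_trace[OF N] J'_def N'_def .
    moreover have "N' \<subseteq> H"
      using conj_mono[OF NH, where g = "inv\<^bsub>G\<^esub> g"]
      unfolding N'_def conj_inv_conj[OF g subgroup.subset[OF KH'(2)]] .
    moreover have "subgroup J' G" "subgroup N' G" "J' \<subseteq> N'"
      unfolding J'_def N'_def
      by (rule conj_sub[OF ig J] conj_sub[OF ig N] conj_mono[OF JN])+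
    ultimately have "(J', N') \<in> T"
      using KH'(4) by blast
    from transfer_conj[OF T g this] show "(J, N) \<in> T"
      unfolding J'_def N'_def
        conj_conj_inv[OF g subgroup.subset[OF J]] conj_conj_inv[OF g subgroup.subset[OF N]] .
  qed
qed

lemma reflecting_restrict:
  assumes "group G" and KH: "(K, H) \<in> reflecting G T" and L: "subgroup L G" "L \<subseteq> H"
  shows "(K \<inter> L, L) \<in> reflecting G T"
proof (rule reflectingI)
  show "subgroup (K \<inter> L) G"
    using group.subgroups_Inter_pair[OF \<open>group G\<close>] reflectingD(1)[OF KH] L(1) by blast
next
  fix J N
  assume JN: "subgroup J G" "subgroup N G" "J \<subseteq> N" "N \<subseteq> L"
    and trace: "(K \<inter> L \<inter> J, K \<inter> L \<inter> N) \<in> T"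
  have "K \<inter> L \<inter> J = K \<inter> J" "K \<inter> L \<inter> N = K \<inter> N" using JN by auto
  then show "(J, N) \<in> T"
    using trace reflectingD(4)[OF KH JN(1-3)] JN(4) L(2) by auto
qed (use L in auto)

text \<open>For \<open>L \<subseteq> K\<close>, the trace on \<open>L\<close> is the trace on \<open>L\<close> of the trace on \<open>K\<close>. Hence transfers
  are reflected in two stages, from \<open>L\<close> to \<open>K\<close> and from \<open>K\<close> to \<open>H\<close>.\<close>

lemma reflecting_trans:
  assumes "group G" and LK: "(L, K) \<in> reflecting G T" and KH: "(K, H) \<in> reflecting G T"
  shows "(L, H) \<in> reflecting G T"
proof (rule reflectingI)
  show "subgroup L G" "subgroup H G" "L \<subseteq> H"
    using reflectingD[OF LK] reflectingD[OF KH] by auto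
next
  fix J N
  assume JN: "subgroup J G" "subgroup N G" "J \<subseteq> N" "N \<subseteq> H"
    and trace: "(L \<inter> J, L \<inter> N) \<in> T"
  have "L \<inter> (K \<inter> J) = L \<inter> J" "L \<inter> (K \<inter> N) = L \<inter> N"
    using reflectingD(3)[OF LK] by auto
  with trace have "(L \<inter> (K \<inter> J), L \<inter> (K \<inter> N)) \<in> T" by simp
  moreover have "subgroup (K \<inter> J) G" "subgroup (K \<inter> N) G"
    using group.subgroups_Inter_pair[OF \<open>group G\<close>] reflectingD(1)[OF KH] JN by blast+
  ultimately have "(K \<inter> J, K \<inter> N) \<in> T"
    using reflectingD(4)[OF LK, of "K \<inter> J" "K \<inter> N"] JN(3) by blast
  then show "(J, N) \<in> T"
    using reflectingD(4)[OF KH] JN by blast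
qed

lemma reflecting_transfer_system:
  assumes "group G" and "transfer_system G T"
  shows "transfer_system G (reflecting G T)"
  unfolding transfer_system_def
proof (intro conjI allI ballI impI; (elim conjE)?)
  fix H assume H: "subgroup H G"
  show "(H, H) \<in> reflecting G T"
  proof (rule reflectingI)
    fix J N assume "J \<subseteq> N" "N \<subseteq> H" "(H \<inter> J, H \<inter> N) \<in> T"
    moreover from this have "H \<inter> J = J" "H \<inter> N = N" by auto
    ultimately show "(J, N) \<in> T" by simp
  qed (use H in auto)
next
  fix L K H assume "(L, K) \<in> reflecting G T" "(K, H) \<in> reflecting G T"
  then show "(L, H) \<in> reflecting G T" by (rule reflecting_trans[OF assms(1)])
next
  fix K H g assume "g \<in> carrier G" "(K, H) \<in> reflecting G T"
  then show "(conjugate G g K, conjugate G g H) \<in> reflecting G T"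
    by (rule group.reflecting_conj[OF assms])
next
  fix K H L assume "(K, H) \<in> reflecting G T" "subgroup L G" "L \<subseteq> H"
  then show "(K \<inter> L, L) \<in> reflecting G T" by (rule reflecting_restrict[OF assms(1)])
qed (fact reflectingD)+

section \<open>The maximal compatible transfer system\<close>

text \<open>Compatibility along \<open>(K, H)\<close> asks for reflection of the pairs \<open>J \<subseteq> H\<close> only, which is the
  case where the larger subgroup is \<open>H\<close> itself.\<close>

lemma compatible_reflecting:
  assumes "group G" and "transfer_system G T"
  shows "compatible_transfer_systems G T (reflecting G T)"
  unfolding compatible_transfer_systems_def
proof (intro conjI allI impI; (elim conjE)?)
  fix K J H
  assume KH: "(K, H) \<in> reflecting G T" and J: "subgroup J G" "J \<subseteq> H" and "(K \<inter> J, K) \<in> T"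
  moreover have "K \<inter> H = K" using reflectingD(3)[OF KH] by auto
  ultimately show "(J, H) \<in> T"
    using reflectingD(2,4)[OF KH] by simp
qed (fact assms(2) reflecting_transfer_system[OF assms] reflecting_subset[OF assms(2)])+

text \<open>The bound \<open>H\<close> is lowered to an arbitrary \<open>N \<subseteq> H\<close> by restriction inside \<open>M\<close>: compatibility
  is applied to \<open>(K \<inter> N, N)\<close>, not to \<open>(K, H)\<close>.\<close>

lemma compatible_subset_reflecting:
  assumes "compatible_transfer_systems G T M"
  shows "M \<subseteq> reflecting G T"
proof (rule subrelI)
  have M: "transfer_system G M"
    using assms by (simp add: compatible_transfer_systems_def)
  fix K H assume KH: "(K, H) \<in> M"
  show "(K, H) \<in> reflecting G T"
  proof (rule reflectingI)
    show "subgroup K G" "subgroup H G" "K \<subseteq> H"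
      using transfer_systemD[OF M KH] by auto
  next
    fix J N
    assume JN: "subgroup J G" "subgroup N G" "J \<subseteq> N" "N \<subseteq> H"
      and trace: "(K \<inter> J, K \<inter> N) \<in> T"
    have KN: "(K \<inter> N, N) \<in> M"
      using transfer_restrict[OF M KH JN(2,4)] .
    have "K \<inter> N \<inter> J = K \<inter> J" using JN(3) by auto
    with trace have "(K \<inter> N \<inter> J, K \<inter> N) \<in> T" by simp
    then show "(J, N) \<in> T"
      using assms KN transfer_systemD[OF M KN] JN
      unfolding compatible_transfer_systems_def by blast
  qed
qed

lemma max_compatible_eq_reflecting:
  assumes "group G" and "transfer_system G T"
  shows "max_compatible G T = reflecting G T"
  unfolding max_compatible_def
  using compatible_reflecting[OF assms] compatible_subset_reflecting
  by (rule Greatest_equality)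

lemma reflecting_enlarge:
  assumes "group G" and T: "transfer_system G T"
    and LH: "(L, H) \<in> reflecting G T" and K: "subgroup K G" "L \<subseteq> K" "K \<subseteq> H"
  shows "(K, H) \<in> reflecting G T"
proof (rule reflectingI)
  fix J N
  assume JN: "subgroup J G" "subgroup N G" "J \<subseteq> N" "N \<subseteq> H"
    and trace: "(K \<inter> J, K \<inter> N) \<in> T"
  have "subgroup (L \<inter> N) G"
    using group.subgroups_Inter_pair[OF \<open>group G\<close>] reflectingD(1)[OF LH] JN(2) by blast
  then have "((K \<inter> J) \<inter> (L \<inter> N), L \<inter> N) \<in> T"
    using transfer_restrict[OF T trace] K(2) by blast
  moreover have "(K \<inter> J) \<inter> (L \<inter> N) = L \<inter> J" using K(2) JN(3) by auto
  ultimately show "(J, N) \<in> T"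
    using reflectingD(4)[OF LH JN] by simp
qed (use K reflectingD(2)[OF LH] in auto)

theorem proposition3p9:
  fixes G :: "('a, 'b) monoid_scheme"
    and T :: "('a set \<times> 'a set) set"
  assumes "group G"
    and "finite (carrier G)"
    and "transfer_system G T"
  shows "saturated_transfer_system G (max_compatible G T)"
  unfolding max_compatible_eq_reflecting[OF assms(1,3)] saturated_transfer_system_def
  using reflecting_transfer_system[OF assms(1,3)] reflecting_enlarge[OF assms(1,3)] by blast

end
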